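(* Let $X$ be a set, $f:X\to X$ a self-map, and equip $X$ with the primal topology $\tau_f$ induced by $f$. The following are equivalent: $f$ is topologically ergodic; $f$ is weakly mixing; $f$ is strongly mixing.
   Context: $\mathbb{N}$ is the set of non-negative integers. The primal topology induced by $f$ on $X$ is $\tau_f=\{A\subseteq X: f^{-1}(A)\subseteq A\}$. For $U,V\subseteq X$ put $D(U,V)=\{k\in\mathbb{N}: f^k(U)\cap V\neq\emptyset\}$. The map $f$ is topologically ergodic if $D(U,V)$ is infinite for every pair of non-empty open sets $U,V$. It is weakly mixing if the map $f_2:X^2\to X^2$, $f_2(x,y)=(f(x),f(y))$, is topologically ergodic for the product topology on $X^2$; equivalently, $D(U_1,V_1)\cap D(U_2,V_2)$ is infinite for all non-empty open sets $U_1,U_2,V_1,V_2$ in $X$. It is strongly mixing if $\mathbb{N}\setminus D(U,V)$ is finite for every pair of non-empty open sets $U,V$ in $X$. *)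

theory Defs
  imports "HOL-Analysis.Analysis"
begin

definition primal_topology :: "'a set \<Rightarrow> ('a \<Rightarrow> 'a) \<Rightarrow> 'a topology" where
  "primal_topology X f = topology (\<lambda>A. A \<subseteq> X \<and> f -` A \<inter> X \<subseteq> A)"

lemma openin_primal_topology:
  "openin (primal_topology X f) A \<longleftrightarrow> A \<subseteq> X \<and> f -` A \<inter> X \<subseteq> A"
proof -
  have "istopology (\<lambda>A. A \<subseteq> X \<and> f -` A \<inter> X \<subseteq> A)"
    unfolding istopology_def by blast
  then show ?thesis
    by (simp add: primal_topology_def topology_inverse')
qed

lemma topspace_primal_topology [simp]: "topspace (primal_topology X f) = X"
proof
  show "topspace (primal_topology X f) \<subseteq> X"
    unfolding topspace_def openin_primal_topology by blast
  have "openin (primal_topology X f) X"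
    by (simp add: openin_primal_topology)
  then show "X \<subseteq> topspace (primal_topology X f)"
    by (rule openin_subset)
qed

definition hitting_times :: "('a \<Rightarrow> 'a) \<Rightarrow> 'a set \<Rightarrow> 'a set \<Rightarrow> nat set" where
  "hitting_times f U V = {k. (f ^^ k) ` U \<inter> V \<noteq> {}}"

definition topologically_ergodic :: "'a topology \<Rightarrow> ('a \<Rightarrow> 'a) \<Rightarrow> bool" where
  "topologically_ergodic T f \<longleftrightarrow>
    (\<forall>U V. openin T U \<and> U \<noteq> {} \<and> openin T V \<and> V \<noteq> {} \<longrightarrow> infinite (hitting_times f U V))"

definition weakly_mixing :: "'a topology \<Rightarrow> ('a \<Rightarrow> 'a) \<Rightarrow> bool" where
  "weakly_mixing T f \<longleftrightarrow> topologically_ergodic (prod_topology T T) (map_prod f f)"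

definition strongly_mixing :: "'a topology \<Rightarrow> ('a \<Rightarrow> 'a) \<Rightarrow> bool" where
  "strongly_mixing T f \<longleftrightarrow>
    (\<forall>U V. openin T U \<and> U \<noteq> {} \<and> openin T V \<and> V \<noteq> {} \<longrightarrow> finite (UNIV - hitting_times f U V))"

end

theory Submission
  imports Defs
begin

text \<open>
  Open sets of the primal topology are closed under preimages. So if the orbit of a point of
  \<open>U\<close> lies in the open set \<open>V\<close> at time \<open>k\<close>, it lies in \<open>V\<close> at every earlier time as well: the
  set of hitting times is an initial segment of the naturals, and once infinite it is everything.
\<close>

lemma funpow_in:
  assumes "f \<in> X \<rightarrow> X" "x \<in> X"
  shows "(f ^^ k) x \<in> X"
  using assms by (induction k) auto

lemma openin_primal_topology_funpow:
  assumes f: "f \<in> X \<rightarrow> X" and V: "openin (primal_topology X f) V"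
    and "x \<in> X" "(f ^^ n) x \<in> V"
  shows "x \<in> V"
  using assms(3,4)
proof (induction n arbitrary: x)
  case (Suc n)
  have "f x \<in> V"
  proof (rule Suc.IH)
    show "f x \<in> X"
      using f Suc.prems(1) by (rule Pi_mem)
    \<comment> \<open>The innermost application of \<open>f\<close> is split off, so that the
      induction hypothesis, general in the point, applies to \<open>f x\<close>; one preimage step
      then leads back to \<open>x\<close>.\<close>
    show "(f ^^ n) (f x) \<in> V"
      using Suc.prems(2) by (simp add: funpow_Suc_right del: funpow.simps)
  qed
  then have "x \<in> f -` V \<inter> X"
    using Suc.prems(1) by simp
  then show ?case
    using V unfolding openin_primal_topology by (elim conjE subsetD)
qed simp

lemma hitting_times_downward_closed:
  assumes f: "f \<in> X \<rightarrow> X" and V: "openin (primal_topology X f) V"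
    and "U \<subseteq> X" and "k \<in> hitting_times f U V" and "j \<le> k"
  shows "j \<in> hitting_times f U V"
proof -
  obtain u where u: "u \<in> U" "(f ^^ k) u \<in> V"
    using assms(4) by (auto simp: hitting_times_def)
  \<comment> \<open>The same \<open>u\<close> witnesses time \<open>j\<close>: its orbit point at
    time \<open>j\<close> still needs \<open>k - j\<close> steps to reach \<open>V\<close>, so it
    already lies in \<open>V\<close>.\<close>
  have "(f ^^ (k - j)) ((f ^^ j) u) = (f ^^ k) u"
    using funpow_add[of "k - j" j f] \<open>j \<le> k\<close> by simp
  then have "(f ^^ j) u \<in> V"
    using openin_primal_topology_funpow[OF f V funpow_in[OF f], of u "k - j" j] u \<open>U \<subseteq> X\<close> by auto
  with u(1) show ?thesis
    by (auto simp: hitting_times_def)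
qed

lemma hitting_times_eq_UNIV:
  assumes "f \<in> X \<rightarrow> X" "openin (primal_topology X f) V" "U \<subseteq> X" "infinite (hitting_times f U V)"
  shows "hitting_times f U V = UNIV"
proof (rule UNIV_eq_I[symmetric])
  fix j
  obtain k where "k \<ge> j" "k \<in> hitting_times f U V"
    using assms(4) unfolding infinite_nat_iff_unbounded_le by blast
  then show "j \<in> hitting_times f U V"
    using hitting_times_downward_closed[OF assms(1-3)] by simp
qed

text \<open>The form in which ergodicity enters both mixing proofs: full sets of hitting times have
  empty complement and also survive intersection.\<close>

lemma topologically_ergodic_primal_hitting_times:
  assumes "f \<in> X \<rightarrow> X" "topologically_ergodic (primal_topology X f) f"
    and "openin (primal_topology X f) U" "U \<noteq> {}"
    and "openin (primal_topology X f) V" "V \<noteq> {}"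
  shows "hitting_times f U V = UNIV"
proof (rule hitting_times_eq_UNIV[OF assms(1,5)])
  show "U \<subseteq> X"
    using assms(3) by (simp add: openin_primal_topology)
  show "infinite (hitting_times f U V)"
    using assms by (simp add: topologically_ergodic_def)
qed

lemma strongly_mixing_imp_topologically_ergodic:
  assumes "strongly_mixing T f"
  shows "topologically_ergodic T f"
  unfolding topologically_ergodic_def
proof (intro allI impI)
  fix U V
  assume "openin T U \<and> U \<noteq> {} \<and> openin T V \<and> V \<noteq> {}"
  then have "finite (UNIV - hitting_times f U V)"
    using assms by (simp add: strongly_mixing_def)
  then show "infinite (hitting_times f U V)"
    \<comment> \<open>A cofinite set of naturals is infinite; the topology plays no part
      here.\<close>
    by (metis finite_Diff2 infinite_UNIV_nat)
qed

text \<open>Iterates of a product map act coordinatewise, and a rectangle is non-empty iff both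
  sides are. This links the product-space definition of weak mixing to simultaneous hitting
  times.\<close>

lemma hitting_times_Times:
  "hitting_times (map_prod f g) (U \<times> U') (V \<times> V') = hitting_times f U V \<inter> hitting_times g U' V'"
proof -
  have "map_prod f g ^^ k = map_prod (f ^^ k) (g ^^ k)" for k
    by (induction k) auto
  then have "(map_prod f g ^^ k) ` (U \<times> U') = (f ^^ k) ` U \<times> (g ^^ k) ` U'" for k
    by (simp add: map_prod_surj_on)
  then show ?thesis
    by (auto simp: hitting_times_def Times_Int_Times)
qed

lemma hitting_times_mono:
  "U \<subseteq> U' \<Longrightarrow> V \<subseteq> V' \<Longrightarrow> hitting_times f U V \<subseteq> hitting_times f U' V'"
  unfolding hitting_times_def by blast

lemma weakly_mixing_imp_topologically_ergodic:
  assumes "weakly_mixing T f"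
  shows "topologically_ergodic T f"
  unfolding topologically_ergodic_def
proof (intro allI impI)
  fix U V
  assume "openin T U \<and> U \<noteq> {} \<and> openin T V \<and> V \<noteq> {}"
  \<comment> \<open>Squaring both sets makes the two coordinate conditions coincide.\<close>
  then have "infinite (hitting_times (map_prod f f) (U \<times> U) (V \<times> V))"
    using assms by (simp add: weakly_mixing_def topologically_ergodic_def openin_prod_Times_iff)
  then show "infinite (hitting_times f U V)"
    by (simp add: hitting_times_Times)
qed

text \<open>Two infinite sets of times could in general have finite intersection; here both are all
  of the naturals.\<close>

lemma topologically_ergodic_primal_imp_weakly_mixing:
  assumes f: "f \<in> X \<rightarrow> X" and erg: "topologically_ergodic (primal_topology X f) f"
  shows "weakly_mixing (primal_topology X f) f"
  unfolding weakly_mixing_def topologically_ergodic_def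
proof (intro allI impI, elim conjE)
  let ?T = "primal_topology X f"
  \<comment> \<open>An open set of the product need not be a rectangle. Shrinking to open boxes is
    harmless, since hitting times only grow with the sets.\<close>
  have box: "\<exists>A B. openin ?T A \<and> A \<noteq> {} \<and> openin ?T B \<and> B \<noteq> {} \<and> A \<times> B \<subseteq> W"
    if W: "openin (prod_topology ?T ?T) W" "W \<noteq> {}" for W
  proof -
    obtain x y where "(x, y) \<in> W"
      using \<open>W \<noteq> {}\<close> by auto
    then have "\<exists>A B. openin ?T A \<and> openin ?T B \<and> x \<in> A \<and> y \<in> B \<and> A \<times> B \<subseteq> W"
      using W(1)[unfolded openin_prod_topology_alt, rule_format] by simp
    then show ?thesis
      by (metis empty_iff)
  qed
  fix U V
  assume "openin (prod_topology ?T ?T) U" "U \<noteq> {}" "openin (prod_topology ?T ?T) V" "V \<noteq> {}"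
  then obtain A B C D where
    AB: "openin ?T A" "A \<noteq> {}" "openin ?T B" "B \<noteq> {}" "A \<times> B \<subseteq> U" and
    CD: "openin ?T C" "C \<noteq> {}" "openin ?T D" "D \<noteq> {}" "C \<times> D \<subseteq> V"
    using box[of U] box[of V] by blast
  have "hitting_times (map_prod f f) (A \<times> B) (C \<times> D) = UNIV"
    using topologically_ergodic_primal_hitting_times[OF f erg] AB CD
    by (simp add: hitting_times_Times)
  then show "infinite (hitting_times (map_prod f f) U V)"
    using hitting_times_mono[OF AB(5) CD(5), of "map_prod f f"] by (simp add: top.extremum_unique)
qed

theorem corollary15:
  fixes X :: "'a set" and f :: "'a \<Rightarrow> 'a"
  assumes "f \<in> X \<rightarrow> X"
  shows "(topologically_ergodic (primal_topology X f) f \<longleftrightarrow> weakly_mixing (primal_topology X f) f) \<and>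
         (weakly_mixing (primal_topology X f) f \<longleftrightarrow> strongly_mixing (primal_topology X f) f)"
proof -
  have "strongly_mixing (primal_topology X f) f" if "topologically_ergodic (primal_topology X f) f"
    using topologically_ergodic_primal_hitting_times[OF assms that] by (simp add: strongly_mixing_def)
  \<comment> \<open>Ergodicity is the hub: each mixing property is shown equivalent to it.\<close>
  then show ?thesis
    using strongly_mixing_imp_topologically_ergodic weakly_mixing_imp_topologically_ergodic
      topologically_ergodic_primal_imp_weakly_mixing[OF assms] by blast
qed

end
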